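(* Let $E^+$ be a set of straight ground clauses and let $E^-$ be a set of ground clauses. If there exists a guarded clause $H$ such that $H \vdash E^+$ and $H \not\vdash E^-$, then there also exists a guarded clause $H'$ such that: (1) the guard of $H'$ is a least general induced guard (induced by $E^+$); (2) $H'$ is a straight clause; (3) $H' \vdash E^+$ and $H' \not\vdash E^-$.
   Context: Clauses are finite disjunctions of first-order literals, treated as sets of literals (no duplicates). A signed relation name is a relation name together with the polarity of a literal in which it occurs. A clause is straight if no signed relation name occurs in it twice. $\phi \vdash \psi$ ($\theta$-subsumption) means there is a variable substitution $\theta$ with $\phi\theta \subseteq \psi$; $H \vdash E$ means $H \vdash C$ for all $C \in E$, and $H \not\vdash E$ means $H \not\vdash C$ for all $C \in E$. A clause is guarded if it contains a literal (a guard) in which all its variables occur. For a set $E$ of straight ground clauses all containing signed relation name $P$, the least general induced guard for $P$ induced by $E$ is the literal $P(\bar x)$ with the least number of distinct variables such that $P(\bar x) \vdash \{P(\bar a)\}$ for every literal $P(\bar a)$ in a clause of $E$ (unique up to renaming); a least general induced guard induced by $E$ is such a literal for some $P$.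
   Formalization: The guarded clause H is assumed to contain only variables as arguments (no constants or function symbols), and H' is shown to be so too; with constants the claim fails, e.g. E+ = {{P(c)}}, E- = {{P(d)}}, H = {P(c)}. *)

theory Defs
  imports Main
begin

text \<open>
  First-order terms over function symbols in \<open>'f\<close> (constants being the nullary ones, \<open>Fun c []\<close>)
  and variables in \<open>'v\<close>.
\<close>

datatype (funs_trm: 'f, vars_trm: 'v) trm =
    Var 'v
  | Fun 'f "('f, 'v) trm list"

primrec subst_trm :: "('v \<Rightarrow> ('f, 'v) trm) \<Rightarrow> ('f, 'v) trm \<Rightarrow> ('f, 'v) trm" where
  "subst_trm \<theta> (Var x) = \<theta> x"
| "subst_trm \<theta> (Fun f ts) = Fun f (map (subst_trm \<theta>) ts)"

text \<open>A signed relation name is a polarity (\<open>True\<close> for positive) with a relation name.\<close>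

type_synonym 'r signed_rel = "bool \<times> 'r"

datatype ('r, 'f, 'v) literal =
  Literal (srel: "'r signed_rel") (args: "('f, 'v) trm list")

type_synonym ('r, 'f, 'v) clause = "('r, 'f, 'v) literal set"

definition vars_lit :: "('r, 'f, 'v) literal \<Rightarrow> 'v set" where
  "vars_lit l = (\<Union>t\<in>set (args l). vars_trm t)"

definition vars_clause :: "('r, 'f, 'v) clause \<Rightarrow> 'v set" where
  "vars_clause C = (\<Union>l\<in>C. vars_lit l)"

definition subst_lit :: "('v \<Rightarrow> ('f, 'v) trm) \<Rightarrow> ('r, 'f, 'v) literal \<Rightarrow> ('r, 'f, 'v) literal" where
  "subst_lit \<theta> l = Literal (srel l) (map (subst_trm \<theta>) (args l))"

definition is_clause :: "('r \<Rightarrow> nat) \<Rightarrow> ('r, 'f, 'v) clause \<Rightarrow> bool" where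
  "is_clause arity C \<longleftrightarrow> finite C \<and> (\<forall>l\<in>C. length (args l) = arity (snd (srel l)))"

definition ground :: "('r, 'f, 'v) clause \<Rightarrow> bool" where
  "ground C \<longleftrightarrow> vars_clause C = {}"

text \<open>
  Since constants are nullary function symbols, the arguments of all literals are variables here.
  This is required of the non-ground clauses that subsume ground ones: an induced guard
  \<open>P(x\<^sub>1, \<dots>, x\<^sub>n)\<close> has variables only, and a guarded clause mentioning constants cannot in general
  be replaced by a straight one with such a guard.
\<close>

definition constant_free :: "('r, 'f, 'v) clause \<Rightarrow> bool" where
  "constant_free C \<longleftrightarrow> (\<forall>l\<in>C. \<forall>t\<in>set (args l). funs_trm t = {})"

definition straight :: "('r, 'f, 'v) clause \<Rightarrow> bool" where
  "straight C \<longleftrightarrow> inj_on srel C"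

definition subsumes :: "('r, 'f, 'v) clause \<Rightarrow> ('r, 'f, 'v) clause \<Rightarrow> bool"
    (infix "\<turnstile>" 50) where
  "C \<turnstile> D \<longleftrightarrow> (\<exists>\<theta>. subst_lit \<theta> ` C \<subseteq> D)"

definition is_guard :: "('r, 'f, 'v) literal \<Rightarrow> ('r, 'f, 'v) clause \<Rightarrow> bool" where
  "is_guard g C \<longleftrightarrow> g \<in> C \<and> vars_clause C \<subseteq> vars_lit g"

definition guarded :: "('r, 'f, 'v) clause \<Rightarrow> bool" where
  "guarded C \<longleftrightarrow> (\<exists>g. is_guard g C)"

definition induces_guard_args ::
    "('r \<Rightarrow> nat) \<Rightarrow> ('r, 'f, 'v) clause set \<Rightarrow> 'r signed_rel \<Rightarrow> 'v list \<Rightarrow> bool" where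
  "induces_guard_args arity E P xs \<longleftrightarrow>
     length xs = arity (snd P) \<and>
     (\<forall>C\<in>E. \<forall>l\<in>C. srel l = P \<longrightarrow> {Literal P (map Var xs)} \<turnstile> {l})"

definition least_general_induced_guard_for ::
    "('r \<Rightarrow> nat) \<Rightarrow> ('r, 'f, 'v) clause set \<Rightarrow> 'r signed_rel \<Rightarrow> ('r, 'f, 'v) literal \<Rightarrow> bool" where
  "least_general_induced_guard_for arity E P g \<longleftrightarrow>
     (\<forall>C\<in>E. P \<in> srel ` C) \<and>
     (\<exists>xs. g = Literal P (map Var xs) \<and>
           is_arg_min (\<lambda>ys. card (set ys)) (induces_guard_args arity E P) xs)"

definition least_general_induced_guard ::
    "('r \<Rightarrow> nat) \<Rightarrow> ('r, 'f, 'v) clause set \<Rightarrow> ('r, 'f, 'v) literal \<Rightarrow> bool" where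
  "least_general_induced_guard arity E g \<longleftrightarrow> (\<exists>P. least_general_induced_guard_for arity E P g)"

end

theory Submission
  imports Defs
begin

text \<open>
  Let \<open>\<theta>\<^sub>C\<close> witness \<open>H \<turnstile> C\<close> for each \<open>C \<in> E\<^sup>+\<close>, and identify two variables of \<open>H\<close> when all \<open>\<theta>\<^sub>C\<close>
  agree on them. The resulting instance \<open>H'\<close> of \<open>H\<close> still subsumes \<open>E\<^sup>+\<close>, and subsumes no clause
  that \<open>H\<close> does not subsume. As each \<open>C \<in> E\<^sup>+\<close> is straight, \<open>\<theta>\<^sub>C\<close> sends literals of \<open>H\<close> with the
  same signed relation name to the same literal, so these are merged in \<open>H'\<close>. Finally, positions
  of the guard of \<open>H'\<close> that carry distinct variables are separated by some \<open>\<theta>\<^sub>C\<close>, hence carry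
  distinct variables in every literal that induces the guard.
\<close>

text \<open>A term \<open>Fun f ts\<close> has \<open>f\<close> among its function symbols, so only
  variables can be arguments here.\<close>

lemma constant_free_literalE:
  assumes "constant_free C" "l \<in> C"
  obtains xs where "args l = map Var xs"
proof -
  have "\<exists>x. t = Var x" if "t \<in> set (args l)" for t
    using assms that by (cases t) (fastforce simp: constant_free_def)+
  then have "\<exists>xs. args l = map Var xs"
    by (simp add: ex_map_conv)
  then show thesis
    using that by blast
qed

lemma subst_trm_compose: "subst_trm \<tau> (subst_trm \<sigma> t) = subst_trm (subst_trm \<tau> \<circ> \<sigma>) t"
  by (induction t) auto

lemma subst_lit_compose: "subst_lit \<tau> (subst_lit \<sigma> l) = subst_lit (subst_trm \<tau> \<circ> \<sigma>) l"
  by (simp add: subst_lit_def subst_trm_compose)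

text \<open>Substitutions compose. Contraposed, this keeps \<open>Eneg\<close> unsubsumed when
  variables are identified.\<close>

lemma subsumes_if_instance_subsumes: "subst_lit \<sigma> ` C \<turnstile> D \<Longrightarrow> C \<turnstile> D"
  by (auto simp: subsumes_def image_image subst_lit_compose)

lemma vars_trm_subst_trm: "vars_trm (subst_trm \<sigma> t) = (\<Union>x\<in>vars_trm t. vars_trm (\<sigma> x))"
  by (induction t) auto

lemma vars_lit_subst_lit: "vars_lit (subst_lit \<sigma> l) = (\<Union>x\<in>vars_lit l. vars_trm (\<sigma> x))"
  by (simp add: vars_lit_def subst_lit_def vars_trm_subst_trm)

text \<open>The variables of an instance depend only on, and grow monotonically with, the variables
  before substitution, so a guard stays a guard.\<close>

lemma is_guard_instance: "is_guard g C \<Longrightarrow> is_guard (subst_lit \<sigma> g) (subst_lit \<sigma> ` C)"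
  by (fastforce simp: is_guard_def vars_clause_def vars_lit_subst_lit)

lemma is_clause_instance: "is_clause arity C \<Longrightarrow> is_clause arity (subst_lit \<sigma> ` C)"
  by (auto simp: is_clause_def subst_lit_def)

lemma srel_subst_lit [simp]: "srel (subst_lit \<sigma> l) = srel l"
  by (simp add: subst_lit_def)

text \<open>Each entry of \<open>xs\<close> is a function of the entry of \<open>ys\<close> at the
  same position, so \<open>set xs\<close> is covered by an image of \<open>set ys\<close>.\<close>

lemma card_set_le_if_positions_determine:
  assumes "length xs = length ys"
    and "\<And>i j. i < length xs \<Longrightarrow> j < length xs \<Longrightarrow> ys ! i = ys ! j \<Longrightarrow> xs ! i = xs ! j"
  shows "card (set xs) \<le> card (set ys)"
proof -
  define pos where "pos y = (SOME i. i < length ys \<and> ys ! i = y)" for y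
  have pos: "pos (ys ! i) < length ys \<and> ys ! pos (ys ! i) = ys ! i" if "i < length ys" for i
    unfolding pos_def by (rule someI[of _ i]) (use that in simp)
  have "set xs \<subseteq> (\<lambda>y. xs ! pos y) ` set ys"
  proof
    fix x assume "x \<in> set xs"
    then obtain i where i: "i < length xs" "x = xs ! i"
      by (metis in_set_conv_nth)
    then have "x = xs ! pos (ys ! i)"
      using assms pos by metis
    then show "x \<in> (\<lambda>y. xs ! pos y) ` set ys"
      using i assms(1) by auto
  qed
  then show ?thesis
    by (meson List.finite_set surj_card_le)
qed

theorem theorem9:
  fixes arity :: "'r \<Rightarrow> nat"
    and Epos Eneg :: "('r, 'f, 'v) clause set"
  assumes "\<forall>C\<in>Epos. is_clause arity C \<and> ground C \<and> straight C"
    and "\<forall>C\<in>Eneg. is_clause arity C \<and> ground C"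
    and "\<exists>H :: ('r, 'f, 'v) clause. is_clause arity H \<and> constant_free H \<and> guarded H \<and>
           (\<forall>C\<in>Epos. H \<turnstile> C) \<and> (\<forall>C\<in>Eneg. \<not> H \<turnstile> C)"
  shows "\<exists>H' :: ('r, 'f, 'v) clause. is_clause arity H' \<and> constant_free H' \<and> guarded H' \<and>
           (\<exists>g. is_guard g H' \<and> least_general_induced_guard arity Epos g) \<and>
           straight H' \<and>
           (\<forall>C\<in>Epos. H' \<turnstile> C) \<and> (\<forall>C\<in>Eneg. \<not> H' \<turnstile> C)"
proof -
  obtain H :: "('r, 'f, 'v) clause" and g where H: "is_clause arity H" "constant_free H"
    "is_guard g H" "\<forall>C\<in>Epos. H \<turnstile> C" "\<forall>C\<in>Eneg. \<not> H \<turnstile> C"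
    using assms(3) unfolding guarded_def by blast
  obtain \<theta> where \<theta>: "subst_lit (\<theta> C) ` H \<subseteq> C" if "C \<in> Epos" for C
    using H(4) unfolding subsumes_def by metis
  \<comment> \<open>\<open>key x\<close> records the values of \<open>x\<close> under all chosen
    witnesses. The fixed value outside \<open>Epos\<close> makes equality of these functions mean
    agreement on \<open>Epos\<close> alone.\<close>
  define key where "key x C = (if C \<in> Epos then \<theta> C x else undefined)" for x C
  have key_iff: "key x = key y \<longleftrightarrow> (\<forall>C\<in>Epos. \<theta> C x = \<theta> C y)" for x y
    unfolding key_def fun_eq_iff by auto
  \<comment> \<open>\<open>inv key\<close> selects one representative from each class of variables
    with the same key.\<close>
  define r where "r x = inv key (key x)" for x
  have key_r: "key (r x) = key x" for x
    unfolding r_def by (simp add: f_inv_into_f)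
  have r_eqI: "r x = r y" if "\<And>C. C \<in> Epos \<Longrightarrow> \<theta> C x = \<theta> C y" for x y
    using that key_iff[of x y] by (simp add: r_def)
  have \<theta>_r: "\<theta> C (r x) = \<theta> C x" if "C \<in> Epos" for C x
    using key_r key_iff that by blast
  define \<rho> :: "'v \<Rightarrow> ('f, 'v) trm" where "\<rho> x = Var (r x)" for x
  define H' where "H' = subst_lit \<rho> ` H"
  have "subst_lit (\<theta> C) ` H' \<subseteq> C" if "C \<in> Epos" for C
  proof -
    \<comment> \<open>\<open>\<theta> C\<close> is constant on each class, so it factors through
      \<open>\<rho>\<close> and is itself a witness for \<open>H'\<close>.\<close>
    have "subst_trm (\<theta> C) \<circ> \<rho> = \<theta> C"
      by (simp add: fun_eq_iff \<rho>_def \<theta>_r that)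
    then show ?thesis
      using \<theta>[OF that] by (simp add: H'_def image_image subst_lit_compose)
  qed
  then have pos: "\<forall>C\<in>Epos. H' \<turnstile> C"
    unfolding subsumes_def by blast
  have neg: "\<forall>C\<in>Eneg. \<not> H' \<turnstile> C"
    using H(5) subsumes_if_instance_subsumes unfolding H'_def by blast
  have guard: "is_guard (subst_lit \<rho> g) H'"
    unfolding H'_def by (rule is_guard_instance[OF H(3)])
  have cf: "constant_free H'"
  proof -
    have "funs_trm t = {}" if l: "l \<in> H" and t: "t \<in> set (args (subst_lit \<rho> l))" for l t
    proof -
      obtain xs where "args l = map Var xs"
        using H(2) l by (rule constant_free_literalE)
      then show ?thesis
        using t by (auto simp: subst_lit_def \<rho>_def)
    qed
    then show ?thesis
      by (auto simp: constant_free_def H'_def)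
  qed
  \<comment> \<open>Straightness leaves \<open>C\<close> only one literal with the given signed
    relation name, which forces the image of \<open>l\<close>.\<close>
  have unique: "subst_lit (\<theta> C) l = m"
    if "C \<in> Epos" "l \<in> H" "m \<in> C" "srel l = srel m" for C l m
  proof -
    have "inj_on srel C"
      using assms(1) that(1) by (simp add: straight_def)
    moreover have "subst_lit (\<theta> C) l \<in> C"
      using \<theta> that by blast
    ultimately show ?thesis
      using that by (metis inj_onD srel_subst_lit)
  qed
  have straight: "straight H'"
  proof -
    have merge: "subst_lit \<rho> l = subst_lit \<rho> m" if lm: "l \<in> H" "m \<in> H" "srel l = srel m" for l m
    proof -
      obtain xs where xs: "args l = map Var xs"
        using H(2) lm(1) by (rule constant_free_literalE)
      obtain ys where ys: "args m = map Var ys"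
        using H(2) lm(2) by (rule constant_free_literalE)
      have len: "length xs = length ys"
        using H(1) lm xs ys unfolding is_clause_def by (metis length_map)
      \<comment> \<open>Both images lie in \<open>C\<close> under one signed relation name, hence
        coincide argument by argument.\<close>
      have maps_eq: "map (\<theta> C) xs = map (\<theta> C) ys" if C: "C \<in> Epos" for C
      proof -
        have "subst_lit (\<theta> C) m \<in> C"
          using \<theta>[OF C] lm(2) by blast
        from unique[OF C lm(1) this] show ?thesis
          by (simp add: lm(3) subst_lit_def xs ys comp_def)
      qed
      have "r (xs ! i) = r (ys ! i)" if "i < length xs" for i
      proof (rule r_eqI)
        fix C assume "C \<in> Epos"
        then have "map (\<theta> C) xs ! i = map (\<theta> C) ys ! i"
          using maps_eq by simp
        then show "\<theta> C (xs ! i) = \<theta> C (ys ! i)"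
          using that len by simp
      qed
      then have "map r xs = map r ys"
        using len by (simp add: list_eq_iff_nth_eq)
      then have "map (subst_trm \<rho>) (args l) = map (subst_trm \<rho>) (args m)"
        by (simp add: xs ys list_eq_iff_nth_eq \<rho>_def)
      then show ?thesis
        by (simp add: subst_lit_def lm(3))
    qed
    show ?thesis
      unfolding straight_def
    proof (rule inj_onI)
      fix a b assume "a \<in> H'" "b \<in> H'" and ab: "srel a = srel b"
      then obtain l m where lm: "l \<in> H" "m \<in> H" "a = subst_lit \<rho> l" "b = subst_lit \<rho> m"
        unfolding H'_def by blast
      then have "srel l = srel m"
        using ab by simp
      then show "a = b"
        using merge lm by blast
    qed
  qed
  have lgg: "least_general_induced_guard arity Epos (subst_lit \<rho> g)"
  proof -
    have gH: "g \<in> H"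
      using H(3) by (simp add: is_guard_def)
    obtain xs where xs: "args g = map Var xs"
      using H(2) gH by (rule constant_free_literalE)
    let ?P = "srel g" and ?xs = "map r xs"
    have g_eq: "subst_lit \<rho> g = Literal ?P (map Var ?xs)"
      by (simp add: subst_lit_def xs \<rho>_def)
    have len: "length xs = arity (snd ?P)"
      using H(1) gH xs unfolding is_clause_def by (metis length_map)
    have occurs: "\<forall>C\<in>Epos. ?P \<in> srel ` C"
    proof
      fix C assume "C \<in> Epos"
      then have "subst_lit (\<theta> C) g \<in> C"
        using \<theta> gH by blast
      then show "?P \<in> srel ` C"
        by (metis image_eqI srel_subst_lit)
    qed
    \<comment> \<open>The witness is \<open>\<theta> C\<close>: it does not distinguish
      \<open>r x\<close> from \<open>x\<close>, and its image of \<open>g\<close> can only be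
      \<open>l\<close>.\<close>
    have "{Literal ?P (map Var ?xs)} \<turnstile> {l}" if "C \<in> Epos" "l \<in> C" "srel l = ?P" for C l
    proof -
      have "subst_lit (\<theta> C) (Literal ?P (map Var ?xs)) = subst_lit (\<theta> C) g"
        using that(1) by (simp add: subst_lit_def xs \<theta>_r)
      also have "\<dots> = l"
        using that gH by (intro unique) simp_all
      finally show ?thesis
        by (auto simp: subsumes_def)
    qed
    then have ind: "induces_guard_args arity Epos ?P ?xs"
      by (simp add: induces_guard_args_def len)
    have "card (set ?xs) \<le> card (set ys)" if ys: "induces_guard_args arity Epos ?P ys" for ys
    proof (rule card_set_le_if_positions_determine)
      show len': "length ?xs = length ys"
        using ys by (simp add: induces_guard_args_def len)
      fix i j
      assume ij: "i < length ?xs" "j < length ?xs" "ys ! i = ys ! j"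
      \<comment> \<open>The literal \<open>P(ys)\<close> is matched against the image of
        \<open>g\<close> in \<open>C\<close>. The matching substitution takes one value at the equal
        entries \<open>i\<close> and \<open>j\<close> of \<open>ys\<close>, so
        \<open>\<theta> C\<close> does so on \<open>xs\<close>.\<close>
      have "\<theta> C (xs ! i) = \<theta> C (xs ! j)" if C: "C \<in> Epos" for C
      proof -
        have "subst_lit (\<theta> C) g \<in> C"
          using \<theta>[OF C] gH by blast
        then have "{Literal ?P (map Var ys)} \<turnstile> {subst_lit (\<theta> C) g}"
          using ys C by (simp add: induces_guard_args_def)
        then obtain \<sigma> where "map \<sigma> ys = map (\<theta> C) xs"
          by (auto simp: subsumes_def subst_lit_def xs comp_def)
        then have "map \<sigma> ys ! i = map (\<theta> C) xs ! i" "map \<sigma> ys ! j = map (\<theta> C) xs ! j"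
          by simp_all
        then show ?thesis
          using ij len' by simp
      qed
      then have "r (xs ! i) = r (xs ! j)"
        by (rule r_eqI)
      then show "?xs ! i = ?xs ! j"
        using ij by simp
    qed
    then have "is_arg_min (\<lambda>ys. card (set ys)) (induces_guard_args arity Epos ?P) ?xs"
      using ind by (simp add: is_arg_min_linorder)
    then show ?thesis
      unfolding least_general_induced_guard_def least_general_induced_guard_for_def
      using occurs g_eq by blast
  qed
  have "is_clause arity H'"
    unfolding H'_def by (rule is_clause_instance[OF H(1)])
  then show ?thesis
    using cf guard lgg straight pos neg unfolding guarded_def by blast
qed

end
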